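(* For any $\mathscr{B}\subset\mathbb{N}$, the subshift $(S,X_\eta)$ has a unique minimal subset. Moreover, this subset is the orbit closure of a Toeplitz sequence.
   Context: $\mathbb{N}=\{1,2,\dots\}$. For $\mathscr{B}\subset\mathbb{N}$ let $\mathcal{M}_{\mathscr{B}}:=\bigcup_{b\in\mathscr{B}}b\mathbb{Z}$, $\mathcal{F}_{\mathscr{B}}:=\mathbb{Z}\setminus\mathcal{M}_{\mathscr{B}}$, and let $\eta\in\{0,1\}^{\mathbb{Z}}$ be the characteristic function of $\mathcal{F}_{\mathscr{B}}$. $\{0,1\}^{\mathbb{Z}}$ carries the product topology, $S$ is the left shift, $(Sx)(n)=x(n+1)$, and $X_\eta$ is the closure of $\{S^m\eta : m\in\mathbb{Z}\}$. A subshift is a pair $(S,X)$ with $X\subset\{0,1\}^{\mathbb{Z}}$ closed and $S$-invariant. A minimal subset of $(S,X)$ is a non-empty, closed, $S$-invariant subset of $X$ that is minimal (under inclusion) with respect to these properties. A sequence $x\in\{0,1\}^{\mathbb{Z}}$ is a Toeplitz sequence if for any $n\in\mathbb{Z}$ there exists $d_n\in\mathbb{N}$ such that $x(n+k d_n)=x(n)$ for all $k\in\mathbb{Z}$ (periodic sequences are included). The orbit closure of $x$ is the closure of $\{S^m x: m\in\mathbb{Z}\}$. *)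

theory Defs
  imports "HOL-Analysis.Analysis"
begin

text \<open>
  The full shift \<open>{0,1}\<^sup>\<int>\<close> is the type \<open>int \<Rightarrow> bool\<close>, with \<open>True\<close> for \<open>1\<close>. Its library topology is
  the product topology of the discrete topology on \<open>bool\<close>.
\<close>

definition multiples_set :: "nat set \<Rightarrow> int set" where
  "multiples_set B = (\<Union>b\<in>B. range (\<lambda>k. int b * k))"

definition free_set :: "nat set \<Rightarrow> int set" where
  "free_set B = UNIV - multiples_set B"

definition eta :: "nat set \<Rightarrow> int \<Rightarrow> bool" where
  "eta B = (\<lambda>n. n \<in> free_set B)"

definition shift :: "(int \<Rightarrow> bool) \<Rightarrow> int \<Rightarrow> bool" where
  "shift x = (\<lambda>n. x (n + 1))"

text \<open>
  The integer power \<open>S\<^sup>m\<close> of the shift \<open>S\<close>. That it is the two-sided iterate of \<open>shift\<close> is shown in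
  \<open>shift_pow_int\<close> and \<open>shift_pow_neg\<close> below.
\<close>

definition shift_pow :: "int \<Rightarrow> (int \<Rightarrow> bool) \<Rightarrow> int \<Rightarrow> bool" where
  "shift_pow m x = (\<lambda>n. x (n + m))"

definition orbit_closure :: "(int \<Rightarrow> bool) \<Rightarrow> (int \<Rightarrow> bool) set" where
  "orbit_closure x = closure (range (\<lambda>m. shift_pow m x))"

definition X_eta :: "nat set \<Rightarrow> (int \<Rightarrow> bool) set" where
  "X_eta B = orbit_closure (eta B)"

text \<open>As \<open>S\<close> is invertible and orbits are two-sided, invariance means \<open>S X = X\<close>.\<close>

definition shift_invariant :: "(int \<Rightarrow> bool) set \<Rightarrow> bool" where
  "shift_invariant X \<longleftrightarrow> shift ` X = X"

definition subshift :: "(int \<Rightarrow> bool) set \<Rightarrow> bool" where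
  "subshift X \<longleftrightarrow> closed X \<and> shift_invariant X"

definition minimal_subset :: "(int \<Rightarrow> bool) set \<Rightarrow> (int \<Rightarrow> bool) set \<Rightarrow> bool" where
  "minimal_subset X M \<longleftrightarrow>
     M \<noteq> {} \<and> closed M \<and> shift_invariant M \<and> M \<subseteq> X \<and>
     (\<forall>M'. M' \<noteq> {} \<and> closed M' \<and> shift_invariant M' \<and> M' \<subseteq> X \<and> M' \<subseteq> M \<longrightarrow> M' = M)"

definition toeplitz :: "(int \<Rightarrow> bool) \<Rightarrow> bool" where
  "toeplitz x \<longleftrightarrow> (\<forall>n. \<exists>d::nat. d \<ge> 1 \<and> (\<forall>k::int. x (n + k * int d) = x n))"

lemma shift_pow_int: "shift_pow (int k) = shift ^^ k"
proof (induction k)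
  case 0
  show ?case by (simp add: shift_pow_def fun_eq_iff)
next
  case (Suc k)
  have "shift_pow (int (Suc k)) x = shift (shift_pow (int k) x)" for x
    by (simp add: shift_pow_def shift_def algebra_simps)
  with Suc show ?case by (intro ext) (simp del: of_nat_Suc)
qed

lemma inv_shift: "inv shift = shift_pow (-1)"
  by (rule inv_unique_comp) (simp_all add: shift_pow_def shift_def fun_eq_iff)

lemma bij_shift: "bij shift"
  by (rule o_bij[of "shift_pow (-1)"]) (simp_all add: shift_pow_def shift_def fun_eq_iff)

lemma shift_pow_neg: "shift_pow (- int k) = inv shift ^^ k"
proof (induction k)
  case 0
  show ?case by (simp add: shift_pow_def fun_eq_iff)
next
  case (Suc k)
  have "shift_pow (- int (Suc k)) x = inv shift (shift_pow (- int k) x)" for x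
    by (simp add: inv_shift shift_pow_def algebra_simps)
  with Suc show ?case by (intro ext) (simp del: of_nat_Suc)
qed

lemma continuous_shift_pow: "continuous_on UNIV (shift_pow m)"
  unfolding shift_pow_def
  by (intro continuous_on_coordinatewise_then_product continuous_on_product_coordinates)

lemma shift_pow_orbit_closure_subset: "shift_pow m ` orbit_closure x \<subseteq> orbit_closure x"
proof -
  have "shift_pow m (shift_pow k x) = shift_pow (m + k) x" for k
    by (simp add: shift_pow_def algebra_simps)
  then have "shift_pow m ` range (\<lambda>k. shift_pow k x) \<subseteq> orbit_closure x"
    unfolding orbit_closure_def by (auto intro!: subsetD[OF closure_subset])
  then show ?thesis
    unfolding orbit_closure_def
    by (intro image_closure_subset) (auto intro: continuous_on_subset[OF continuous_shift_pow])
qed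

lemma subshift_orbit_closure: "subshift (orbit_closure x)"
proof -
  have shift_eq: "shift = shift_pow 1"
    by (simp add: shift_def shift_pow_def fun_eq_iff)
  have "y \<in> shift ` orbit_closure x" if "y \<in> orbit_closure x" for y
  proof
    show "y = shift (shift_pow (-1) y)"
      by (simp add: shift_def shift_pow_def)
    show "shift_pow (-1) y \<in> orbit_closure x"
      using shift_pow_orbit_closure_subset that by blast
  qed
  then have "shift ` orbit_closure x = orbit_closure x"
    using shift_pow_orbit_closure_subset[of 1 x] by (auto simp: shift_eq)
  then show ?thesis
    by (simp add: subshift_def shift_invariant_def orbit_closure_def)
qed

lemma subshift_X_eta: "subshift (X_eta B)"
  unfolding X_eta_def by (rule subshift_orbit_closure)

end

theory Submission
  imports Defs
begin

text \<open>
  The only arithmetic property of \<open>\<eta>\<close> that matters is that every arithmetic progression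
  \<open>m + d\<int>\<close> contains a progression \<open>m' + d'\<int>\<close> on which \<open>\<eta>\<close> is constant: either \<open>\<eta>\<close> is already
  \<open>1\<close> throughout \<open>m + d\<int>\<close>, or some \<open>m' \<in> m + d\<int>\<close> is divisible by a \<open>b \<in> B\<close>, and then \<open>\<eta>\<close>
  vanishes on \<open>m' + db\<int>\<close> (lemma \<open>freezes_progressions_eta\<close>).

  For any sequence \<open>z\<close> with this property, run through all coordinates \<open>n \<in> \<int>\<close> and shrink
  progressions one coordinate at a time. This gives nested progressions \<open>m\<^sub>k + d\<^sub>k\<int>\<close> such that
  the \<open>n\<close>-th coordinate of \<open>S\<^sup>c z\<close> is the same for all \<open>c\<close> in the progression belonging to \<open>n\<close>.
  Call this common value \<open>x(n)\<close> (lemma \<open>frozen_limit_exists\<close>).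

  \<^item> The sequence \<open>x\<close> is Toeplitz: the period at \<open>n\<close> is the modulus belonging to \<open>n\<close>.
  \<^item> Every finite pattern of \<open>x\<close> occurs in \<open>z\<close> along a whole progression, hence with bounded
    gaps, and bounded gaps pass to limits of shifts of \<open>z\<close>. So \<open>x\<close> lies in the orbit closure of
    \<^emph>\<open>every\<close> \<open>y\<close> in the orbit closure of \<open>z\<close>.

  By the second point, each non-empty closed invariant subset of the orbit closure of \<open>z\<close>
  contains the orbit closure of \<open>x\<close>, which is therefore the unique minimal subset.
\<close>

section \<open>Closure and invariance in the full shift\<close>

lemma closure_bool_seq_iff:
  fixes x :: "int \<Rightarrow> bool"
  shows "x \<in> closure A \<longleftrightarrow> (\<forall>F. finite F \<longrightarrow> (\<exists>a\<in>A. \<forall>i\<in>F. a i = x i))"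
proof
  assume x: "x \<in> closure A"
  show "\<forall>F. finite F \<longrightarrow> (\<exists>a\<in>A. \<forall>i\<in>F. a i = x i)"
  proof (intro allI impI)
    fix F :: "int set" assume "finite F"
    then have "open {a :: int \<Rightarrow> bool. \<forall>i\<in>F. a i \<in> {x i}}"
      using product_topology_basis'[of F "\<lambda>i. {x i}" id] by (simp add: open_discrete)
    then show "\<exists>a\<in>A. \<forall>i\<in>F. a i = x i"
      using x closure_iff_nhds_not_empty[of x A] by fastforce
  qed
next
  assume match: "\<forall>F. finite F \<longrightarrow> (\<exists>a\<in>A. \<forall>i\<in>F. a i = x i)"
  have "\<exists>a\<in>A. a \<in> U" if U: "open U" "x \<in> U" for U
  proof -
    obtain V where V: "x \<in> Pi\<^sub>E UNIV V" "finite {i. V i \<noteq> UNIV}" "Pi\<^sub>E UNIV V \<subseteq> U"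
      using product_topology_open_contains_basis[of "\<lambda>_. euclidean" UNIV U x] U
      unfolding open_fun_def by auto
    obtain a where a: "a \<in> A" "\<And>i. V i \<noteq> UNIV \<Longrightarrow> a i = x i"
      using match V(2) by auto
    have "a i \<in> V i" for i
      using a(2)[of i] V(1) by (cases "V i = UNIV") (auto simp: PiE_iff)
    with V(3) have "a \<in> U"
      by (auto simp: PiE_iff)
    with a(1) show ?thesis by blast
  qed
  then show "x \<in> closure A"
    by (auto simp: closure_iff_nhds_not_empty)
qed

lemma orbit_closure_iff:
  "x \<in> orbit_closure y \<longleftrightarrow> (\<forall>F. finite F \<longrightarrow> (\<exists>m. \<forall>i\<in>F. y (i + m) = x i))"
  by (simp add: orbit_closure_def closure_bool_seq_iff shift_pow_def)

lemma self_in_orbit_closure: "x \<in> orbit_closure x"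
  unfolding orbit_closure_iff by (metis add_0_right)

lemma shift_pow_invariant:
  assumes "shift_invariant M" "y \<in> M"
  shows "shift_pow m y \<in> M"
proof -
  have fwd: "shift u \<in> M" and bwd: "inv shift u \<in> M" if "u \<in> M" for u
    using assms(1) that bij_shift unfolding shift_invariant_def
    by (auto simp: bij_is_inj inv_f_f) (metis bij_is_inj image_iff inv_f_f)
  have "(shift ^^ k) y \<in> M" "(inv shift ^^ k) y \<in> M" for k
    by (induction k) (auto simp: fwd bwd assms(2))
  then show ?thesis
    by (cases m rule: int_cases2) (simp_all only: shift_pow_int shift_pow_neg)
qed

lemma orbit_closure_least:
  assumes "closed M" "shift_invariant M" "y \<in> M"
  shows "orbit_closure y \<subseteq> M"
  unfolding orbit_closure_def
  using assms shift_pow_invariant by (intro closure_minimal) auto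

text \<open>
  A point that is approximated by every orbit of a subshift generates the smallest non-empty
  closed invariant subset of it, and a smallest such set is the only minimal one.
\<close>

lemma minimal_subset_iff_of_universal_point:
  assumes X: "subshift X" and x: "x \<in> X" and univ: "\<And>y. y \<in> X \<Longrightarrow> x \<in> orbit_closure y"
  shows "minimal_subset X M \<longleftrightarrow> M = orbit_closure x"
proof -
  let ?O = "orbit_closure x"
  have O: "closed ?O" "shift_invariant ?O" "?O \<noteq> {}" "?O \<subseteq> X"
    using subshift_orbit_closure[of x] self_in_orbit_closure[of x] orbit_closure_least X x
    by (auto simp: subshift_def)
  have least: "?O \<subseteq> N" if "closed N" "shift_invariant N" "N \<noteq> {}" "N \<subseteq> X" for N
  proof -
    obtain y where "y \<in> N"
      using \<open>N \<noteq> {}\<close> by blast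
    then have "x \<in> N"
      using univ orbit_closure_least that by blast
    then show ?thesis
      using orbit_closure_least that by blast
  qed
  show ?thesis
  proof
    assume "minimal_subset X M"
    then show "M = ?O"
      unfolding minimal_subset_def using O least[of M] by metis
  next
    assume "M = ?O"
    then show "minimal_subset X M"
      unfolding minimal_subset_def using O least by (simp add: subset_antisym)
  qed
qed

section \<open>Sequences that freeze along progressions\<close>

definition freezes_progressions :: "(int \<Rightarrow> bool) \<Rightarrow> bool" where
  "freezes_progressions z \<longleftrightarrow>
     (\<forall>m d. d \<ge> 1 \<longrightarrow> (\<exists>m' d'. d' \<ge> 1 \<and> d dvd m' - m \<and> d dvd d' \<and>
       (\<forall>j. z (m' + j * d') = z m')))"

lemma freezes_progressions_eta:
  assumes "B \<subseteq> {1..}"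
  shows "freezes_progressions (eta B)"
  unfolding freezes_progressions_def
proof (intro allI impI)
  fix m d :: int assume d: "d \<ge> 1"
  have eta_iff: "eta B n \<longleftrightarrow> (\<forall>b\<in>B. \<not> int b dvd n)" for n
    by (auto simp: eta_def free_set_def multiples_set_def dvd_def)
  show "\<exists>m' d'. d' \<ge> 1 \<and> d dvd m' - m \<and> d dvd d' \<and> (\<forall>j. eta B (m' + j * d') = eta B m')"
  proof (cases "\<forall>j. eta B (m + j * d)")
    case True
    then have "\<forall>j. eta B (m + j * d) = eta B m"
      by (metis add_0_right mult_zero_left)
    with d show ?thesis
      by (intro exI[of _ m] exI[of _ d]) simp
  next
    case False
    then obtain j b where b: "b \<in> B" "int b dvd m + j * d"
      by (auto simp: eta_iff)
    then have "b \<ge> 1"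
      using assms by auto
    with d have "1 * 1 \<le> d * int b"
      by (intro mult_mono) auto
    moreover have "\<not> eta B (m + j * d + i * (d * int b))" for i
      using b by (auto simp: eta_iff intro!: bexI[of _ b])
    moreover have "\<not> eta B (m + j * d)"
      using b by (auto simp: eta_iff)
    ultimately show ?thesis
      by (intro exI[of _ "m + j * d"] exI[of _ "d * int b"]) simp
  qed
qed

text \<open>
  The progressions are nested along an enumeration of \<open>\<int>\<close>, so a single one of them serves any
  given finite set of coordinates. The diagonal limit over these progressions is \<open>x\<close>.
\<close>

lemma frozen_limit_exists:
  assumes "freezes_progressions z"
  obtains x where "\<And>F. finite F \<Longrightarrow> \<exists>m d. d \<ge> 1 \<and> (\<forall>n\<in>F. \<forall>j. z (m + j * d + n) = x n)"
    and "toeplitz x"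
proof -
  define P where "P k p \<longleftrightarrow> snd p \<ge> 1 \<and>
      (\<forall>j. z (fst p + j * snd p + from_nat k) = z (fst p + from_nat k))"
    for k and p :: "int \<times> int"
  define Q where "Q p q \<longleftrightarrow> snd p dvd fst q - fst p \<and> snd p dvd snd q" for p q :: "int \<times> int"
  have step: "\<exists>q. P k q \<and> Q p q" if "snd p \<ge> 1" for k p
  proof -
    obtain m' d' where "d' \<ge> 1" "snd p dvd m' - (fst p + from_nat k)" "snd p dvd d'"
        "\<forall>j. z (m' + j * d') = z m'"
      using assms \<open>snd p \<ge> 1\<close> unfolding freezes_progressions_def by blast
    then have "P k (m' - from_nat k, d') \<and> Q p (m' - from_nat k, d')"
      by (simp add: P_def Q_def algebra_simps)
    then show ?thesis ..
  qed
  have "\<exists>f. \<forall>k. P k (f k) \<and> Q (f k) (f (Suc k))"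
  proof (rule dependent_nat_choice)
    show "\<exists>p. P 0 p"
      using step[of "(0, 1)" 0] by auto
    show "\<exists>q. P (Suc k) q \<and> Q p q" if "P k p" for p k
      using step[of p "Suc k"] that by (simp add: P_def)
  qed
  then obtain f where P: "\<And>k. P k (f k)" and Q: "\<And>k. Q (f k) (f (Suc k))"
    by blast
  define m d where "m k = fst (f k)" and "d k = snd (f k)" for k
  have d: "d k \<ge> 1" for k
    using P[of k] by (simp add: P_def d_def)
  have nested: "d k dvd m l - m k \<and> d k dvd d l" if "k \<le> l" for k l
    using that
  proof (induction l rule: dec_induct)
    case base
    show ?case by simp
  next
    case (step l)
    have l: "d l dvd m (Suc l) - m l" "d l dvd d (Suc l)"
      using Q[of l] by (simp_all add: Q_def m_def d_def)
    have "d k dvd (m (Suc l) - m l) + (m l - m k)"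
      using step.IH l by (intro dvd_add) (auto intro: dvd_trans)
    then show ?case
      using step.IH l by (auto intro: dvd_trans)
  qed
  define x where "x n = z (m (to_nat n) + n)" for n
  have frozen: "z (c + n) = x n" if c: "d (to_nat n) dvd c - m (to_nat n)" for c n
  proof -
    obtain j where "c - m (to_nat n) = d (to_nat n) * j"
      using c by (elim dvdE)
    then have j: "c = m (to_nat n) + j * d (to_nat n)"
      by (simp add: algebra_simps)
    show ?thesis
      using P[of "to_nat n"] by (simp add: P_def j x_def m_def d_def)
  qed
  have uniform: "z (m l + j * d l + n) = x n" if "to_nat n \<le> l" for l j n
  proof (rule frozen)
    have "d (to_nat n) dvd (m l - m (to_nat n)) + j * d l"
      using nested[OF that] by simp
    then show "d (to_nat n) dvd m l + j * d l - m (to_nat n)"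
      by (simp add: algebra_simps)
  qed
  show ?thesis
  proof
    fix F :: "int set" assume "finite F"
    then have "\<forall>n\<in>F. to_nat n \<le> Max (to_nat ` F)"
      by simp
    then show "\<exists>m d. d \<ge> 1 \<and> (\<forall>n\<in>F. \<forall>j. z (m + j * d + n) = x n)"
      using uniform d by blast
  next
    have "x (n + k * d (to_nat n)) = x n" for n k
    proof -
      let ?t = "k * d (to_nat n)"
      \<comment> \<open>The base point \<open>m l\<close> serves both coordinates, and adding \<open>?t\<close> to it stays in the
        progression belonging to \<open>n\<close>.\<close>
      define l where "l = max (to_nat n) (to_nat (n + ?t))"
      have "x (n + ?t) = z (m l + (n + ?t))"
        using uniform[of "n + ?t" l 0] by (simp add: l_def)
      also have "\<dots> = z ((m l + ?t) + n)"
        by (simp add: algebra_simps)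
      also have "\<dots> = x n"
      proof (rule frozen)
        have "d (to_nat n) dvd (m l - m (to_nat n)) + ?t"
          using nested[of "to_nat n" l] by (simp add: l_def)
        then show "d (to_nat n) dvd m l + ?t - m (to_nat n)"
          by (simp add: algebra_simps)
      qed
      finally show ?thesis .
    qed
    moreover have "nat (d (to_nat n)) \<ge> 1 \<and> int (nat (d (to_nat n))) = d (to_nat n)" for n :: int
      using d[of "to_nat n"] by simp
    ultimately show "toeplitz x"
      unfolding toeplitz_def by metis
  qed
qed

text \<open>
  On the finite window \<open>F + {0,\<dots>,d-1}\<close>, \<open>y\<close> agrees with some shift of \<open>z\<close>. As any \<open>d\<close> consecutive
  integers meet the progression along which the pattern recurs in \<open>z\<close>, this window of \<open>y\<close> already
  contains the pattern.
\<close>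

lemma recurrent_patterns_in_orbit_closure:
  assumes recurs: "\<And>F. finite F \<Longrightarrow> \<exists>m d. d \<ge> 1 \<and> (\<forall>n\<in>F. \<forall>j. z (m + j * d + n) = x n)"
    and y: "y \<in> orbit_closure z"
  shows "x \<in> orbit_closure y"
  unfolding orbit_closure_iff
proof (intro allI impI)
  fix F :: "int set" assume F: "finite F"
  obtain m d where d: "d \<ge> 1" and x: "\<And>n j. n \<in> F \<Longrightarrow> z (m + j * d + n) = x n"
    using recurs[OF F] by blast
  have "finite ((\<lambda>(n, r). n + r) ` (F \<times> {0..<d}))"
    using F by simp
  then obtain s where s: "\<And>n r. n \<in> F \<Longrightarrow> r \<in> {0..<d} \<Longrightarrow> z (n + r + s) = y (n + r)"
    using y unfolding orbit_closure_iff by fastforce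
  define r where "r = (m - s) mod d"
  have "r \<in> {0..<d}"
    using d by (simp add: r_def)
  have "n + r + s = m + (- ((m - s) div d)) * d + n" for n
    using div_mult_mod_eq[of "m - s" d] by (simp add: r_def algebra_simps)
  then have "y (n + r) = x n" if "n \<in> F" for n
    using s[OF that \<open>r \<in> {0..<d}\<close>] x[OF that] by metis
  then show "\<exists>r. \<forall>n\<in>F. y (n + r) = x n"
    by blast
qed

section \<open>The unique minimal subset\<close>

theorem theorem1:
  fixes B :: "nat set"
  assumes "B \<subseteq> {1..}"
  shows "(\<exists>!M. minimal_subset (X_eta B) M) \<and>
         (\<forall>M. minimal_subset (X_eta B) M \<longrightarrow> (\<exists>x. toeplitz x \<and> M = orbit_closure x))"
proof -
  obtain x where recurs: "\<And>F. finite F \<Longrightarrow>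
        \<exists>m d. d \<ge> 1 \<and> (\<forall>n\<in>F. \<forall>j. eta B (m + j * d + n) = x n)"
    and toeplitz: "toeplitz x"
    using frozen_limit_exists[OF freezes_progressions_eta[OF assms]] by metis
  have univ: "x \<in> orbit_closure y" if "y \<in> X_eta B" for y
    using recurrent_patterns_in_orbit_closure[OF recurs] that by (simp add: X_eta_def)
  have "x \<in> X_eta B"
    using univ[of "eta B"] self_in_orbit_closure by (simp add: X_eta_def)
  with univ have "minimal_subset (X_eta B) M \<longleftrightarrow> M = orbit_closure x" for M
    using minimal_subset_iff_of_universal_point subshift_X_eta by blast
  with toeplitz show ?thesis
    by blast
qed

end
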